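(* Let $p,q$ be nonnegative integers and let $T$ be an orthogonal transformation on the space $\mathbb{R}^{p,q}$. Suppose there exist invertible elements $s_1,s_2,\ldots,s_k\in\mathbb{R}^{p,q}$ such that: (1) $T(x)=(-1)^{k}s_1\cdots s_{k-1}s_k\,x\,s_k^{-1}s_{k-1}^{-1}\cdots s_2^{-1}s_1^{-1}$ for all $x\in\mathbb{R}^{p,q}$ (products in the Clifford algebra $\mathbb{R}_{p,q}$); (2) $\mathrm{gr}(s_1\cdots s_{k-1}s_k)=t$; (3) $\mathrm{Ker}(T-I)$ is a non-degenerate subspace of $\mathbb{R}^{p,q}$. Then $T$ can be factored into $t$ reflections with respect to hyperplanes and, moreover, $\dim\left(\left(\mathrm{Ker}(T-I)\right)^{\perp}\right)=t$.
   Context: $\mathbb{R}^{p,q}$ denotes the real vector space $\mathbb{R}^{n}$, $n=p+q$, equipped with the non-degenerate symmetric bilinear form $\mathcal{B}(x,y)=\sum_{i=1}^{p}x_iy_i-\sum_{i=p+1}^{p+q}x_iy_i$. A linear operator $T$ on $\mathbb{R}^{p,q}$ is an orthogonal transformation if $\mathcal{B}(Tv,Tw)=\mathcal{B}(v,w)$ for all $v,w$. For a subspace $W$, $W^{\perp}=\{u:\mathcal{B}(v,u)=0\text{ for all }v\in W\}$, and $W$ is non-degenerate if the restriction of $\mathcal{B}$ to $W\times W$ is non-degenerate. A vector $a\in\mathbb{R}^{p,q}$ is invertible if $\mathcal{B}(a,a)\neq0$. For invertible $a$, the hyperplane associated with $a$ is $H_a=(\mathbb{R}a)^{\perp}$,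 and the reflection with respect to $H_a$ is the linear map $\varphi_a(\lambda a+b)=-\lambda a+b$ ($\lambda\in\mathbb{R}$, $b\in H_a$); "reflection with respect to a hyperplane" always means such a map. The identity is regarded as the product of zero reflections. $\mathbb{R}_{p,q}$ denotes the Clifford algebra of $\mathbb{R}^{p,q}$ of dimension $2^n$: the real associative unital algebra containing $\mathbb{R}$ and $\mathbb{R}^{p,q}$ as linear subspaces, generated by them, with $v^2=\mathcal{B}(v,v)$ for all $v\in\mathbb{R}^{p,q}$. An invertible vector $s$ has inverse $s^{-1}=s/\mathcal{B}(s,s)$ in $\mathbb{R}_{p,q}$. With $e_1,\ldots,e_n$ the canonical (orthonormal) basis of $\mathbb{R}^{p,q}$, $N=\{1,\ldots,n\}$, and $e_A=e_{\alpha_1}\cdots e_{\alpha_s}$ for $A=\{\alpha_1<\cdots<\alpha_s\}\subseteq N$ ($e_\emptyset=1$), the $e_A$ form a basis of $\mathbb{R}_{p,q}$; $\mathbb{R}_{p,q}^{r}$ is the span of the $e_A$ with $\#A=r$, so every $a\in\mathbb{R}_{p,q}$ is uniquely $a=\sum_{r=0}^n a_r$ with $a_r\in\mathbb{R}_{p,q}^r$. The grade of $a\neq0$ is $\mathrm{gr}(a)=t$ if $a_t\neq0$ and $a_r=0$ for all $r>t$. *)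

theory Defs
  imports Complex_Main "HOL-Library.Function_Algebras"
begin

text \<open>
  Vectors are functions \<open>nat \<Rightarrow> real\<close> with the pointwise vector space structure; addition comes from
  \<^theory>\<open>HOL-Library.Function_Algebras\<close>, scalar multiplication is added here.
\<close>

instantiation "fun" :: (type, real_vector) real_vector
begin

definition scaleR_fun :: "real \<Rightarrow> ('a \<Rightarrow> 'b) \<Rightarrow> 'a \<Rightarrow> 'b" where
  "scaleR_fun c f = (\<lambda>x. c *\<^sub>R f x)"

instance
  by standard
    (simp_all add: scaleR_fun_def plus_fun_def fun_eq_iff scaleR_add_right scaleR_add_left)

end

section \<open>The space of signature \<open>(p, q)\<close>\<close>

text \<open>
  Only the coordinates \<open>1, \<dots>, p + q\<close> are used, so that \<open>p\<close> and \<open>q\<close> can be arbitrary natural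
  numbers (including \<open>p = q = 0\<close>); the remaining ones vanish.
\<close>

definition Rpq :: "nat \<Rightarrow> nat \<Rightarrow> (nat \<Rightarrow> real) set" where
  "Rpq p q = {x. \<forall>i. i \<notin> {1..p + q} \<longrightarrow> x i = 0}"

definition bform :: "nat \<Rightarrow> nat \<Rightarrow> (nat \<Rightarrow> real) \<Rightarrow> (nat \<Rightarrow> real) \<Rightarrow> real" where
  "bform p q x y = (\<Sum>i=1..p. x i * y i) - (\<Sum>i=p+1..p+q. x i * y i)"

definition unit_vec :: "nat \<Rightarrow> nat \<Rightarrow> real" where
  "unit_vec i = (\<lambda>j. if j = i then 1 else 0)"

text \<open>
  Operators on \<^term>\<open>Rpq p q\<close> are total functions of which only the restriction to
  \<^term>\<open>Rpq p q\<close> matters.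
\<close>

definition linear_operator :: "nat \<Rightarrow> nat \<Rightarrow> ((nat \<Rightarrow> real) \<Rightarrow> nat \<Rightarrow> real) \<Rightarrow> bool" where
  "linear_operator p q T \<longleftrightarrow>
     (\<forall>x\<in>Rpq p q. T x \<in> Rpq p q) \<and>
     (\<forall>x\<in>Rpq p q. \<forall>y\<in>Rpq p q. T (x + y) = T x + T y) \<and>
     (\<forall>c. \<forall>x\<in>Rpq p q. T (c *\<^sub>R x) = c *\<^sub>R T x)"

definition orthogonal_operator :: "nat \<Rightarrow> nat \<Rightarrow> ((nat \<Rightarrow> real) \<Rightarrow> nat \<Rightarrow> real) \<Rightarrow> bool" where
  "orthogonal_operator p q T \<longleftrightarrow>
     linear_operator p q T \<and>
     (\<forall>v\<in>Rpq p q. \<forall>w\<in>Rpq p q. bform p q (T v) (T w) = bform p q v w)"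

definition fixed_space :: "nat \<Rightarrow> nat \<Rightarrow> ((nat \<Rightarrow> real) \<Rightarrow> nat \<Rightarrow> real) \<Rightarrow> (nat \<Rightarrow> real) set" where
  "fixed_space p q T = {x \<in> Rpq p q. T x - x = 0}"

definition perp :: "nat \<Rightarrow> nat \<Rightarrow> (nat \<Rightarrow> real) set \<Rightarrow> (nat \<Rightarrow> real) set" where
  "perp p q W = {u \<in> Rpq p q. \<forall>v\<in>W. bform p q v u = 0}"

definition nondegenerate :: "nat \<Rightarrow> nat \<Rightarrow> (nat \<Rightarrow> real) set \<Rightarrow> bool" where
  "nondegenerate p q W \<longleftrightarrow> (\<forall>v\<in>W. (\<forall>w\<in>W. bform p q v w = 0) \<longrightarrow> v = 0)"

definition invertible_vec :: "nat \<Rightarrow> nat \<Rightarrow> (nat \<Rightarrow> real) \<Rightarrow> bool" where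
  "invertible_vec p q a \<longleftrightarrow> a \<in> Rpq p q \<and> bform p q a a \<noteq> 0"

definition vec_inv :: "nat \<Rightarrow> nat \<Rightarrow> (nat \<Rightarrow> real) \<Rightarrow> nat \<Rightarrow> real" where
  "vec_inv p q s = (1 / bform p q s s) *\<^sub>R s"

definition hyperplane :: "nat \<Rightarrow> nat \<Rightarrow> (nat \<Rightarrow> real) \<Rightarrow> (nat \<Rightarrow> real) set" where
  "hyperplane p q a = perp p q (span {a})"

definition hyperplane_reflection :: "nat \<Rightarrow> nat \<Rightarrow> ((nat \<Rightarrow> real) \<Rightarrow> nat \<Rightarrow> real) \<Rightarrow> bool" where
  "hyperplane_reflection p q \<phi> \<longleftrightarrow>
     linear_operator p q \<phi> \<and>
     (\<exists>a. invertible_vec p q a \<and>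
        (\<forall>l. \<forall>b\<in>hyperplane p q a. \<phi> (l *\<^sub>R a + b) = - l *\<^sub>R a + b))"

definition product_of_reflections ::
    "nat \<Rightarrow> nat \<Rightarrow> nat \<Rightarrow> ((nat \<Rightarrow> real) \<Rightarrow> nat \<Rightarrow> real) \<Rightarrow> bool" where
  "product_of_reflections p q m T \<longleftrightarrow>
     (\<exists>\<phi>s. length \<phi>s = m \<and> (\<forall>\<phi>\<in>set \<phi>s. hyperplane_reflection p q \<phi>) \<and>
        (\<forall>x\<in>Rpq p q. T x = foldr (\<circ>) \<phi>s id x))"

section \<open>The Clifford algebra of dimension \<open>2\<^sup>n\<close>\<close>

text \<open>
  The type \<open>'a\<close> is the algebra itself (for each \<open>p\<close> and \<open>q\<close> it is unique up to isomorphism), and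
  \<open>emb\<close> is the inclusion of \<^term>\<open>Rpq p q\<close>; the reals are included by \<^const>\<open>of_real\<close>.
  As \<^term>\<open>dim S = 0\<close> for infinite-dimensional \<open>S\<close>, \<open>dim_algebra\<close> entails finite dimension.
\<close>

locale clifford_algebra =
  fixes p q :: nat
    and emb :: "(nat \<Rightarrow> real) \<Rightarrow> 'a::real_algebra_1"
  assumes emb_add: "\<lbrakk>x \<in> Rpq p q; y \<in> Rpq p q\<rbrakk> \<Longrightarrow> emb (x + y) = emb x + emb y"
    and emb_scale: "x \<in> Rpq p q \<Longrightarrow> emb (c *\<^sub>R x) = c *\<^sub>R emb x"
    and emb_inj: "inj_on emb (Rpq p q)"
    and emb_square: "v \<in> Rpq p q \<Longrightarrow> emb v * emb v = of_real (bform p q v v)"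
    and generated: "\<lbrakk>subspace S; range of_real \<subseteq> S; emb ` Rpq p q \<subseteq> S;
                      \<forall>a\<in>S. \<forall>b\<in>S. a * b \<in> S\<rbrakk> \<Longrightarrow> S = (UNIV :: 'a set)"
    and dim_algebra: "dim (UNIV :: 'a set) = 2 ^ (p + q)"

definition basis_blade :: "((nat \<Rightarrow> real) \<Rightarrow> 'a::real_algebra_1) \<Rightarrow> nat set \<Rightarrow> 'a" where
  "basis_blade emb A = prod_list (map (\<lambda>i. emb (unit_vec i)) (sorted_list_of_set A))"

definition grade_space ::
    "nat \<Rightarrow> nat \<Rightarrow> ((nat \<Rightarrow> real) \<Rightarrow> 'a::real_algebra_1) \<Rightarrow> nat \<Rightarrow> 'a set" where
  "grade_space p q emb r = span {basis_blade emb A |A. A \<subseteq> {1..p + q} \<and> card A = r}"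

definition grade_part ::
    "nat \<Rightarrow> nat \<Rightarrow> ((nat \<Rightarrow> real) \<Rightarrow> 'a::real_algebra_1) \<Rightarrow> nat \<Rightarrow> 'a \<Rightarrow> 'a" where
  "grade_part p q emb r a =
     (THE f. (\<forall>i. f i \<in> grade_space p q emb i) \<and> a = (\<Sum>i\<le>p + q. f i)) r"

text \<open>As in the usual definition, the value at \<open>a = 0\<close> is of no significance.\<close>

definition grade :: "nat \<Rightarrow> nat \<Rightarrow> ((nat \<Rightarrow> real) \<Rightarrow> 'a::real_algebra_1) \<Rightarrow> 'a \<Rightarrow> nat" where
  "grade p q emb a =
     (THE t. grade_part p q emb t a \<noteq> 0 \<and> (\<forall>r>t. grade_part p q emb r a = 0))"

end

theory Submission
  imports Defs
begin

text \<open>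
  Let \<open>F = Ker (T - I)\<close> and \<open>m = dim F\<^sup>\<bottom>\<close>. If \<open>m > 0\<close>, then the quadratic forms \<open>\<B> x x\<close> and
  \<open>\<B> (T x - x) (T x - x)\<close> are both nonzero on \<open>F\<^sup>\<bottom>\<close>, so some \<open>x \<in> F\<^sup>\<bottom>\<close> makes \<open>x\<close> and
  \<open>a = T x - x\<close> both non-isotropic. The reflection \<open>\<phi>\<close> in the hyperplane of \<open>a\<close> maps \<open>T x\<close> to \<open>x\<close>,
  so \<open>\<phi> \<circ> T\<close> has the fixed space \<open>F + \<real>x\<close>, which is again non-degenerate; by induction \<open>T\<close> is a
  product of \<open>m\<close> reflections.

  If \<open>s\<close> has parity \<open>k\<close> and \<open>T v s = (-1)\<^sup>k s v\<close> for all vectors \<open>v\<close>, then \<open>s' = a s\<close> stands in the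
  same relation to \<open>\<phi> \<circ> T\<close>. Evaluating the relation at \<open>v = x\<close> shows \<open>a s = - (x s - (-1)\<^sup>k s x)\<close>, which
  up to a factor is the contraction of \<open>s\<close> by \<open>x\<close> and hence lowers the grade, whereas \<open>s = a\<^sup>-\<^sup>1 s'\<close>
  raises the grade of \<open>s'\<close> by at most one. So each reflection split off lowers the grade by exactly
  one, and for \<open>m = 0\<close> all contractions of \<open>s\<close> vanish, which makes \<open>s\<close> a nonzero scalar.
\<close>

section \<open>The bilinear form\<close>

lemma subspace_Rpq: "subspace (Rpq p q)"
  by (auto simp: subspace_def Rpq_def scaleR_fun_def plus_fun_def)

lemma bform_add_left: "bform p q (x + y) z = bform p q x z + bform p q y z"
  by (simp add: bform_def plus_fun_def algebra_simps sum.distrib)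

lemma bform_scale_left: "bform p q (c *\<^sub>R x) z = c * bform p q x z"
  by (simp add: bform_def scaleR_fun_def algebra_simps sum_distrib_left)

lemma bform_commute: "bform p q x y = bform p q y x"
  by (simp add: bform_def mult.commute)

lemma bform_add_right: "bform p q z (x + y) = bform p q z x + bform p q z y"
  using bform_add_left bform_commute by metis

lemma bform_scale_right: "bform p q z (c *\<^sub>R x) = c * bform p q z x"
  using bform_scale_left bform_commute by metis

lemma bform_diff_left: "bform p q (x - y) z = bform p q x z - bform p q y z"
  using bform_add_left[of p q x "- y" z] bform_scale_left[of p q "- 1" y z] by simp

lemma bform_diff_right: "bform p q z (x - y) = bform p q z x - bform p q z y"
  using bform_diff_left bform_commute by metis

lemma bform_zero_left: "bform p q 0 z = 0"
  and bform_zero_right: "bform p q z 0 = 0"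
  using bform_scale_left[of p q 0 0 z] bform_scale_right[of p q z 0 0] by simp_all

lemmas bform_linear_simps =
  bform_add_left bform_scale_left bform_add_right bform_scale_right
  bform_diff_left bform_diff_right bform_zero_left bform_zero_right

lemma unit_vec_in_Rpq: "i \<in> {1..p + q} \<Longrightarrow> unit_vec i \<in> Rpq p q"
  by (auto simp: unit_vec_def Rpq_def)

lemma bform_unit_vec:
  assumes "i \<in> {1..p + q}"
  shows "bform p q x (unit_vec i) = (if i \<le> p then x i else - x i)"
  using assms by (auto simp: bform_def unit_vec_def if_distrib[of "(*) _"] cong: if_cong)

lemma bform_nondegenerate:
  assumes "x \<in> Rpq p q" and "\<And>y. y \<in> Rpq p q \<Longrightarrow> bform p q x y = 0"
  shows "x = 0"
proof
  fix i
  show "x i = 0 i"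
  proof (cases "i \<in> {1..p + q}")
    case True
    then show ?thesis
      using assms(2)[OF unit_vec_in_Rpq[OF True]] bform_unit_vec[OF True, of x]
      by (auto split: if_splits)
  qed (use assms(1) in \<open>auto simp: Rpq_def\<close>)
qed

lemma Rpq_subset_span: "Rpq p q \<subseteq> span (unit_vec ` {1..p + q})"
proof
  fix x assume x: "x \<in> Rpq p q"
  have sum_apply: "(\<Sum>i\<in>I. f i) j = (\<Sum>i\<in>I. f i j)" if "finite I"
    for I :: "nat set" and f :: "nat \<Rightarrow> nat \<Rightarrow> real" and j
    using that by (induction I) auto
  have "x = (\<Sum>i\<in>{1..p + q}. x i *\<^sub>R unit_vec i)"
  proof
    fix j
    show "x j = (\<Sum>i\<in>{1..p + q}. x i *\<^sub>R unit_vec i) j"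
      using x by (simp add: sum_apply scaleR_fun_def unit_vec_def Rpq_def
          if_distrib[of "(*) _"] cong: if_cong)
  qed
  moreover have "(\<Sum>i\<in>{1..p + q}. x i *\<^sub>R unit_vec i) \<in> span (unit_vec ` {1..p + q})"
    by (intro span_sum span_scale span_base imageI)
  ultimately show "x \<in> span (unit_vec ` {1..p + q})"
    by simp
qed

text \<open>Used contrapositively throughout: a subspace without non-isotropic vectors is totally
  isotropic, which can then be refuted by nondegeneracy.\<close>

lemma polarization:
  assumes S: "subspace S" and iso: "\<And>x. x \<in> S \<Longrightarrow> bform p q x x = 0"
    and "x \<in> S" "y \<in> S"
  shows "bform p q x y = 0"
proof -
  have "bform p q (x + y) (x + y) = 0"
    using assms by (simp add: subspace_add)
  then show ?thesis
    using iso[of x] iso[of y] assms(3,4) bform_commute[of p q y x] by (simp add: bform_linear_simps)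
qed

section \<open>Orthogonal complements and projections\<close>

lemma subspace_perp: "subspace (perp p q W)"
  using subspace_Rpq[of p q] by (auto simp: subspace_def perp_def bform_linear_simps)

text \<open>Subtracting the component along \<open>a\<close> sends \<open>S\<close> into the vectors
  of \<open>S\<close> orthogonal to \<open>a\<close>, so a basis of those together with
  \<open>a\<close> is a basis of \<open>S\<close>.\<close>

lemma dim_orthogonal_complement:
  assumes S: "subspace S" "S \<subseteq> Rpq p q" and a: "a \<in> S" "bform p q a a \<noteq> 0"
  shows "dim S = Suc (dim {v \<in> S. bform p q v a = 0})"
proof -
  let ?S' = "{v \<in> S. bform p q v a = 0}"
  have S': "subspace ?S'"
    using S(1) by (auto simp: subspace_def bform_linear_simps)
  obtain B where B: "B \<subseteq> ?S'" "independent B" "?S' \<subseteq> span B" "card B = dim ?S'"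
    using basis_exists by blast
  have spB: "span B = ?S'"
    using B S' by (simp add: span_minimal subset_antisym)
  \<comment> \<open>The ambient type is infinite-dimensional, so finiteness has to come from the
    unit vectors spanning \<open>Rpq p q\<close>; without it \<open>card (insert a B)\<close> would
    not be the successor of \<open>card B\<close>.\<close>
  have "finite B"
    using independent_span_bound[OF _ B(2), of "unit_vec ` {1..p + q}"] B(1) S(2)
      Rpq_subset_span[of p q] by blast
  have aB: "a \<notin> span B"
    using a by (simp add: spB)
  have "S \<subseteq> span (insert a B)"
  proof
    fix v assume v: "v \<in> S"
    have "v - (bform p q v a / bform p q a a) *\<^sub>R a \<in> ?S'"
      using v a S(1) by (simp add: subspace_diff subspace_scale bform_linear_simps)
    then show "v \<in> span (insert a B)"
      unfolding span_breakdown_eq spB by blast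
  qed
  moreover have "insert a B \<subseteq> S"
    using B(1) a by auto
  moreover have "independent (insert a B)"
    using aB B(2) by (rule independent_insertI)
  ultimately have "card (insert a B) = dim S"
    by (intro basis_card_eq_dim) auto
  moreover have "a \<notin> B"
    using aB span_base by blast
  ultimately show ?thesis
    using \<open>finite B\<close> B(4) by simp
qed

text \<open>Orthogonal projection, by splitting off one non-isotropic vector of \<open>F\<close> at a time.\<close>

lemma nondegenerate_decomposition:
  assumes "subspace F" "F \<subseteq> Rpq p q" "nondegenerate p q F" "x \<in> Rpq p q"
  obtains f where "f \<in> F" "x - f \<in> perp p q F"
proof -
  have "\<exists>f\<in>F. x - f \<in> perp p q F"
    using assms
  proof (induction "dim F" arbitrary: F x rule: less_induct)
    case less
    show ?case
    proof (cases "\<forall>a\<in>F. bform p q a a = 0")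
      case True
      then have "\<And>v w. v \<in> F \<Longrightarrow> w \<in> F \<Longrightarrow> bform p q v w = 0"
        using polarization[OF less.prems(1)] by blast
      then have "F = {0}"
        using less.prems(1,3) subspace_0 by (auto simp: nondegenerate_def)
      then show ?thesis
        using less.prems(4) by (simp add: perp_def bform_linear_simps)
    next
      case False
      then obtain a where a: "a \<in> F" "bform p q a a \<noteq> 0"
        by blast
      define F1 where "F1 = {v \<in> F. bform p q v a = 0}"
      define pr where "pr v = v - (bform p q v a / bform p q a a) *\<^sub>R a" for v
      have pr_orth: "bform p q (pr v) a = 0" for v
        using a by (simp add: pr_def bform_linear_simps)
      have prF1: "pr v \<in> F1" if "v \<in> F" for v
        using that a less.prems(1) pr_orth[of v]
        by (simp add: F1_def pr_def subspace_diff subspace_scale)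
      have F1: "subspace F1" "F1 \<subseteq> Rpq p q"
        using less.prems(1,2) by (auto simp: F1_def subspace_def bform_linear_simps)
      have bform_pr: "bform p q u (pr w) = bform p q u w" if "bform p q u a = 0" for u w
        using that by (simp add: pr_def bform_linear_simps)
      have "nondegenerate p q F1"
        unfolding nondegenerate_def
      proof (intro ballI impI)
        fix v assume v: "v \<in> F1" and "\<forall>w\<in>F1. bform p q v w = 0"
        \<comment> \<open>Since \<open>v\<close> is orthogonal to \<open>a\<close>, pairing it with
          \<open>w\<close> or with the projection \<open>pr w\<close> in \<open>F1\<close> gives the
          same value; so \<open>v\<close> is orthogonal to all of \<open>F\<close>.\<close>
        then have "\<forall>w\<in>F. bform p q v (pr w) = 0"
          using prF1 by blast
        then have "\<forall>w\<in>F. bform p q v w = 0"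
          using v bform_pr[of v] by (simp add: F1_def)
        then show "v = 0"
          using v less.prems(3) by (auto simp: nondegenerate_def F1_def)
      qed
      moreover have "dim F1 < dim F"
        using dim_orthogonal_complement[OF less.prems(1,2) a] by (simp add: F1_def)
      moreover have prx: "pr x \<in> Rpq p q"
        using less.prems(2,4) a(1) subspace_Rpq[of p q] unfolding pr_def
        by (intro subspace_diff subspace_scale) auto
      ultimately obtain f where f: "f \<in> F1" "pr x - f \<in> perp p q F1"
        using less.hyps F1 by blast
      have fa: "bform p q f a = 0" "f \<in> F"
        using f(1) by (simp_all add: F1_def)
      have orth: "bform p q (pr x - f) a = 0"
        using pr_orth fa by (simp add: bform_linear_simps)
      have "bform p q w (pr x - f) = 0" if "w \<in> F" for w
        using f(2) prF1[OF that] bform_pr[OF orth, of w]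
        by (simp add: perp_def bform_commute[of p q w] bform_commute[of p q _ "pr x - f"])
      then have "pr x - f \<in> perp p q F"
        using f(2) by (simp add: perp_def)
      moreover have "pr x - f = x - (f + (bform p q x a / bform p q a a) *\<^sub>R a)"
        by (simp add: pr_def algebra_simps)
      moreover have "f + (bform p q x a / bform p q a a) *\<^sub>R a \<in> F"
        using fa a(1) less.prems(1) by (simp add: subspace_add subspace_scale)
      ultimately show ?thesis
        by metis
    qed
  qed
  then show thesis
    using that by blast
qed

section \<open>Splitting off a reflection\<close>

definition reflect :: "nat \<Rightarrow> nat \<Rightarrow> (nat \<Rightarrow> real) \<Rightarrow> (nat \<Rightarrow> real) \<Rightarrow> nat \<Rightarrow> real" where
  "reflect p q a v = v - (2 * bform p q v a / bform p q a a) *\<^sub>R a"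

lemma reflect_in_Rpq: "a \<in> Rpq p q \<Longrightarrow> v \<in> Rpq p q \<Longrightarrow> reflect p q a v \<in> Rpq p q"
  unfolding reflect_def using subspace_Rpq[of p q] by (intro subspace_diff subspace_scale)

lemma reflect_add: "reflect p q a (v + w) = reflect p q a v + reflect p q a w"
  by (simp add: reflect_def bform_linear_simps algebra_simps add_divide_distrib)

lemma reflect_scale: "reflect p q a (c *\<^sub>R v) = c *\<^sub>R reflect p q a v"
  by (simp add: reflect_def bform_linear_simps algebra_simps)

lemma reflect_reflect: "bform p q a a \<noteq> 0 \<Longrightarrow> reflect p q a (reflect p q a v) = v"
  by (simp add: reflect_def bform_linear_simps flip: scaleR_add_left)

lemma bform_reflect:
  "bform p q a a \<noteq> 0 \<Longrightarrow> bform p q (reflect p q a v) (reflect p q a w) = bform p q v w"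
  by (simp add: reflect_def bform_linear_simps bform_commute[of p q a w])

lemma hyperplane_reflection_reflect:
  assumes "invertible_vec p q a"
  shows "hyperplane_reflection p q (reflect p q a)"
  unfolding hyperplane_reflection_def
proof (intro conjI exI allI ballI)
  show "linear_operator p q (reflect p q a)"
    using assms by (simp add: linear_operator_def invertible_vec_def reflect_in_Rpq reflect_add
        reflect_scale)
  fix l b assume "b \<in> hyperplane p q a"
  then have "bform p q b a = 0"
    by (auto simp: hyperplane_def perp_def span_base bform_commute)
  then show "reflect p q a (l *\<^sub>R a + b) = - l *\<^sub>R a + b"
    using assms by (simp add: invertible_vec_def reflect_def bform_linear_simps algebra_simps
        flip: scaleR_add_left)
qed (fact assms)

section \<open>The fixed space and the displacements \<open>T x - x\<close>\<close>

lemma subspace_fixed_space: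
  assumes "linear_operator p q T"
  shows "subspace (fixed_space p q T)"
proof -
  have "0 \<in> Rpq p q"
    by (rule subspace_0[OF subspace_Rpq])
  moreover from this have "T (0 *\<^sub>R 0) = 0 *\<^sub>R T 0"
    using assms unfolding linear_operator_def by blast
  ultimately show ?thesis
    using assms subspace_Rpq[of p q] by (simp add: fixed_space_def linear_operator_def subspace_def)
qed

text \<open>For a fixed vector f, B(f, T x) = B(T f, T x) = B(f, x).\<close>

lemma image_minus_id_subset_perp:
  assumes "orthogonal_operator p q T" "x \<in> Rpq p q"
  shows "T x - x \<in> perp p q (fixed_space p q T)"
proof -
  have "bform p q f (T x - x) = 0" if f: "f \<in> fixed_space p q T" for f
  proof -
    have "f \<in> Rpq p q" "T f = f"
      using f by (simp_all add: fixed_space_def)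
    then have "bform p q f (T x) = bform p q f x"
      using assms unfolding orthogonal_operator_def by metis
    then show ?thesis
      using f by (simp add: fixed_space_def bform_linear_simps)
  qed
  moreover have "T x - x \<in> Rpq p q"
    using assms subspace_Rpq by (simp add: orthogonal_operator_def linear_operator_def subspace_diff)
  ultimately show ?thesis
    by (simp add: perp_def)
qed

text \<open>T x and x have the same square. The identity makes the coefficient in
  \<open>reflect p q (T x - x) (T x)\<close> equal to 1, so that this reflection takes T x to
  x.\<close>

lemma bform_Tx_minus_x:
  assumes "orthogonal_operator p q T" "x \<in> Rpq p q"
  shows "bform p q (T x - x) (T x - x) = 2 * bform p q (T x - x) (T x)"
  using assms bform_commute[of p q x "T x"]
  by (simp add: orthogonal_operator_def bform_linear_simps)

text \<open>
  If the image of \<open>T - I\<close> were totally isotropic, orthogonality would give \<open>(T - I)\<^sup>2 = 0\<close>, so that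
  \<open>T x - x\<close> would lie in \<open>Ker (T - I) \<inter> (Ker (T - I))\<^sup>\<bottom> = 0\<close>.
\<close>

lemma ex_nonisotropic_displacement:
  assumes T: "orthogonal_operator p q T" and F: "nondegenerate p q (fixed_space p q T)"
    and ne: "x \<in> Rpq p q" "T x \<noteq> x"
  shows "\<exists>z\<in>Rpq p q. bform p q (T z - z) (T z - z) \<noteq> 0"
proof (rule ccontr)
  assume contra: "\<not> ?thesis"
  have lin: "linear_operator p q T"
    using T by (simp add: orthogonal_operator_def)
  have V: "T v \<in> Rpq p q" "T v - v \<in> Rpq p q" if "v \<in> Rpq p q" for v
    using that lin subspace_Rpq by (auto simp: linear_operator_def subspace_diff)
  have T_diff: "T (v - w) = T v - T w" if "v \<in> Rpq p q" "w \<in> Rpq p q" for v w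
  proof -
    have "T (v - w + w) = T (v - w) + T w"
      using that lin subspace_Rpq unfolding linear_operator_def by (metis subspace_diff)
    then show ?thesis
      by (simp add: algebra_simps)
  qed
  have iso: "bform p q (T v - v) (T w - w) = 0" if "v \<in> Rpq p q" "w \<in> Rpq p q" for v w
  proof -
    let ?D = "(\<lambda>v. T v - v) ` Rpq p q"
    have "subspace ?D"
    proof (rule subspaceI)
      show "0 \<in> ?D"
        using T_diff[of 0 0] subspace_0[OF subspace_Rpq] by force
      fix v w assume "v \<in> ?D" "w \<in> ?D"
      then obtain v' w' where "v' \<in> Rpq p q" "w' \<in> Rpq p q" "v = T v' - v'" "w = T w' - w'"
        by blast
      then have "v' + w' \<in> Rpq p q" "v + w = T (v' + w') - (v' + w')"
        using lin subspace_Rpq by (auto simp: linear_operator_def subspace_add)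
      then show "v + w \<in> ?D"
        by blast
    next
      fix c v assume "v \<in> ?D"
      then obtain v' where "v' \<in> Rpq p q" "v = T v' - v'"
        by blast
      then have "c *\<^sub>R v' \<in> Rpq p q" "c *\<^sub>R v = T (c *\<^sub>R v') - c *\<^sub>R v'"
        using lin subspace_Rpq by (auto simp: linear_operator_def subspace_scale scaleR_diff_right)
      then show "c *\<^sub>R v \<in> ?D"
        by blast
    qed
    then show ?thesis
      by (rule polarization) (use contra that in auto)
  qed
  let ?n = "T x - x"
  have n: "?n \<in> Rpq p q"
    using V ne by blast
  \<comment> \<open>Expanding B(T n - n, T y - y) = 0 and using B(T n, T y) = B(n, y) = B(n, T y)
    leaves -B(T n - n, y) = 0.\<close>
  have "bform p q (T ?n - ?n) y = 0" if y: "y \<in> Rpq p q" for y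
  proof -
    have "bform p q (T ?n) (T y) = bform p q ?n y"
      using T n y by (simp add: orthogonal_operator_def)
    moreover have "bform p q (T ?n - ?n) (T y - y) = 0" "bform p q ?n (T y - y) = 0"
      using iso n y ne by blast+
    ultimately show ?thesis
      by (simp add: bform_linear_simps)
  qed
  then have "T ?n - ?n = 0"
    using bform_nondegenerate V n by blast
  then have nF: "?n \<in> fixed_space p q T"
    using n by (simp add: fixed_space_def)
  moreover have "bform p q ?n w = 0" if "w \<in> fixed_space p q T" for w
    using image_minus_id_subset_perp[OF T ne(1)] that by (simp add: perp_def bform_commute)
  ultimately have "?n = 0"
    using F unfolding nondegenerate_def by blast
  then show False
    using ne by simp
qed

text \<open>Two nonzero polynomials have only finitely many roots together. The coefficients assumed
  nonzero differ because in the application one form is nonzero at the base point of a line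
  (constant term) and the other at its direction (leading term).\<close>

lemma ex_common_nonroot:
  fixes a0 a1 a2 b0 b1 b2 :: real
  assumes "a0 \<noteq> 0" "b2 \<noteq> 0"
  shows "\<exists>e. a0 + a1 * e + a2 * e\<^sup>2 \<noteq> 0 \<and> b0 + b1 * e + b2 * e\<^sup>2 \<noteq> 0"
proof -
  have fin: "finite {e. c0 + c1 * e + c2 * e\<^sup>2 = 0}" if "c0 \<noteq> 0 \<or> c2 \<noteq> 0" for c0 c1 c2 :: real
  proof -
    let ?c = "\<lambda>i :: nat. if i = 0 then c0 else if i = 1 then c1 else c2"
    have "?c 0 \<noteq> 0 \<or> ?c 2 \<noteq> 0"
      using that by simp
    then have "finite {e. (\<Sum>i\<le>2. ?c i * e ^ i) = 0}"
      unfolding polyfun_finite_roots by blast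
    moreover have "(\<Sum>i\<le>2. ?c i * e ^ i) = c0 + c1 * e + c2 * e\<^sup>2" for e
      by (simp add: numeral_2_eq_2)
    ultimately show ?thesis
      by simp
  qed
  have "finite ({e. a0 + a1 * e + a2 * e\<^sup>2 = 0} \<union> {e. b0 + b1 * e + b2 * e\<^sup>2 = 0})"
    using fin assms by simp
  then obtain e where "e \<notin> {e. a0 + a1 * e + a2 * e\<^sup>2 = 0} \<union> {e. b0 + b1 * e + b2 * e\<^sup>2 = 0}"
    using ex_new_if_finite infinite_UNIV_char_0 by blast
  then show ?thesis
    by auto
qed

text \<open>One vector y of the complement is non-isotropic, another vector z has a non-isotropic
  displacement; some y + e z has both properties.\<close>

lemma ex_reduction_vector:
  assumes T: "orthogonal_operator p q T" and F: "nondegenerate p q (fixed_space p q T)"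
    and ne: "fixed_space p q T \<noteq> Rpq p q"
  obtains x where "x \<in> perp p q (fixed_space p q T)" "bform p q x x \<noteq> 0"
    "bform p q (T x - x) (T x - x) \<noteq> 0"
proof -
  let ?F = "fixed_space p q T"
  let ?U = "perp p q ?F"
  have lin: "linear_operator p q T"
    using T by (simp add: orthogonal_operator_def)
  have sF: "subspace ?F" "?F \<subseteq> Rpq p q"
    using subspace_fixed_space[OF lin] by (auto simp: fixed_space_def)
  have UV: "?U \<subseteq> Rpq p q"
    by (auto simp: perp_def)
  obtain x0 where "x0 \<in> Rpq p q" "T x0 \<noteq> x0"
    using ne sF(2) by (auto simp: fixed_space_def)
  then obtain z0 where z0: "z0 \<in> Rpq p q" "bform p q (T z0 - z0) (T z0 - z0) \<noteq> 0"
    using ex_nonisotropic_displacement[OF T F] by blast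
  \<comment> \<open>Removing the fixed component moves z0 into the complement without changing its
    displacement.\<close>
  obtain f where f: "f \<in> ?F" "z0 - f \<in> ?U"
    using nondegenerate_decomposition[OF sF F z0(1)] .
  define z where "z = z0 - f"
  have z: "z \<in> ?U" "z \<in> Rpq p q"
    using f UV by (auto simp: z_def)
  have "T (z + f) = T z + T f"
    using lin f z sF(2) by (auto simp: linear_operator_def)
  then have "T z0 - z0 = T z - z"
    using f(1) by (simp add: z_def fixed_space_def algebra_simps)
  with z0 have Qz: "bform p q (T z - z) (T z - z) \<noteq> 0"
    by simp
  \<comment> \<open>Otherwise z would be orthogonal to the complement as well as to the fixed space,
    hence to everything, and would vanish together with its displacement.\<close>
  have "\<exists>y\<in>?U. bform p q y y \<noteq> 0"
  proof (rule ccontr)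
    assume contra: "\<not> ?thesis"
    have "bform p q z v = 0" if v: "v \<in> Rpq p q" for v
    proof -
      obtain g where g: "g \<in> ?F" "v - g \<in> ?U"
        using nondegenerate_decomposition[OF sF F v] .
      have "bform p q z (v - g) = 0"
        by (rule polarization[OF subspace_perp[of p q ?F]]) (use contra g(2) z(1) in auto)
      moreover have "bform p q z g = 0"
        using g(1) z(1) by (simp add: perp_def bform_commute)
      ultimately show ?thesis
        by (simp add: bform_linear_simps)
    qed
    then have "z = 0"
      using bform_nondegenerate z(2) by blast
    moreover have "T 0 = 0"
      using subspace_0[OF sF(1)] by (simp add: fixed_space_def)
    ultimately show False
      using Qz by (simp add: bform_linear_simps)
  qed
  then obtain y where y: "y \<in> ?U" "bform p q y y \<noteq> 0"
    by blast
  let ?dy = "T y - y" and ?dz = "T z - z"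
  obtain e where e:
    "bform p q y y + (2 * bform p q y z) * e + bform p q z z * e\<^sup>2 \<noteq> 0"
    "bform p q ?dy ?dy + (2 * bform p q ?dy ?dz) * e + bform p q ?dz ?dz * e\<^sup>2 \<noteq> 0"
    using ex_common_nonroot[OF y(2) Qz] by blast
  have quad: "bform p q (u + e *\<^sub>R v) (u + e *\<^sub>R v) =
      bform p q u u + (2 * bform p q u v) * e + bform p q v v * e\<^sup>2" for u v
    using bform_commute[of p q v u]
    by (simp add: bform_add_left bform_scale_left bform_add_right bform_scale_right
        power2_eq_square algebra_simps)
  let ?x = "y + e *\<^sub>R z"
  have yV: "y \<in> Rpq p q"
    using y UV by auto
  have "T ?x = T y + e *\<^sub>R T z"
    using lin yV z(2) subspace_scale[OF subspace_Rpq] by (simp add: linear_operator_def)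
  then have dx: "T ?x - ?x = ?dy + e *\<^sub>R ?dz"
    by (simp add: algebra_simps)
  have "bform p q (T ?x - ?x) (T ?x - ?x) \<noteq> 0"
    unfolding dx quad using e(2) .
  moreover have "bform p q ?x ?x \<noteq> 0"
    using e(1) quad by simp
  moreover have "?x \<in> ?U"
    using y z subspace_perp by (simp add: subspace_add subspace_scale)
  ultimately show thesis
    using that by blast
qed

text \<open>The new fixed space is the old one plus the line through x. As x is non-isotropic and
  orthogonal to the old one, nondegeneracy survives, and the complement is cut down to its vectors
  orthogonal to x.\<close>

lemma reflect_comp_reduces_displacement:
  assumes T: "orthogonal_operator p q T" and F: "nondegenerate p q (fixed_space p q T)"
    and x: "x \<in> perp p q (fixed_space p q T)" "bform p q x x \<noteq> 0"
    and a: "a = T x - x" "bform p q a a \<noteq> 0"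
    and T': "T' = reflect p q a \<circ> T"
  shows "orthogonal_operator p q T'"
    and "nondegenerate p q (fixed_space p q T')"
    and "dim (perp p q (fixed_space p q T)) = Suc (dim (perp p q (fixed_space p q T')))"
proof -
  let ?F = "fixed_space p q T"
  have lin: "linear_operator p q T"
    using T by (simp add: orthogonal_operator_def)
  have xV: "x \<in> Rpq p q"
    using x by (simp add: perp_def)
  have aV: "a \<in> Rpq p q"
    using xV lin subspace_Rpq unfolding a linear_operator_def by (simp add: subspace_diff)
  have sF: "subspace ?F"
    using subspace_fixed_space[OF lin] .
  show T'_orth: "orthogonal_operator p q T'"
    using T aV a(2)
    by (simp add: T' orthogonal_operator_def linear_operator_def reflect_in_Rpq reflect_add
        reflect_scale bform_reflect)
  have T'x: "T' x = x"
    using bform_Tx_minus_x[OF T xV] a bform_commute[of p q "T x" a]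
    by (simp add: T' reflect_def)
  have "T' f = f" if "f \<in> ?F" for f
  proof -
    have "bform p q f a = 0"
      using image_minus_id_subset_perp[OF T xV] that by (simp add: perp_def a)
    then show ?thesis
      using that by (simp add: T' reflect_def fixed_space_def)
  qed
  then have sub1: "?F \<subseteq> fixed_space p q T'"
    by (auto simp: fixed_space_def)
  have lin': "linear_operator p q T'"
    using T'_orth by (simp add: orthogonal_operator_def)
  have xF': "x \<in> fixed_space p q T'"
    using T'x xV by (simp add: fixed_space_def)
  \<comment> \<open>If T' fixes v, then T v - v is a multiple c a = c (T x - x) of the reflecting
    vector, so T fixes v - c x.\<close>
  have decomp: "\<exists>c. v - c *\<^sub>R x \<in> ?F" if v: "v \<in> fixed_space p q T'" for v
  proof -
    have vV: "v \<in> Rpq p q"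
      using v by (simp add: fixed_space_def)
    define c where "c = 2 * bform p q (T v) a / bform p q a a"
    have "T v - c *\<^sub>R a = v"
      using v by (simp add: fixed_space_def T' reflect_def c_def)
    then have "T v - v = c *\<^sub>R (T x - x)"
      unfolding a(1)[symmetric] by (simp add: algebra_simps)
    moreover have "T (v - c *\<^sub>R x) = T v - c *\<^sub>R T x"
    proof -
      have w: "- c *\<^sub>R x \<in> Rpq p q"
        using subspace_scale[OF subspace_Rpq xV] .
      have "T (v + (- c *\<^sub>R x)) = T v + T (- c *\<^sub>R x)" "T (- c *\<^sub>R x) = - c *\<^sub>R T x"
        using lin vV xV w unfolding linear_operator_def by blast+
      then show ?thesis
        by simp
    qed
    then have "T (v - c *\<^sub>R x) - (v - c *\<^sub>R x) = (T v - v) - c *\<^sub>R (T x - x)"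
      by (simp add: algebra_simps)
    ultimately have "T (v - c *\<^sub>R x) - (v - c *\<^sub>R x) = 0"
      by simp
    then show ?thesis
      using vV xV subspace_Rpq by (auto simp: fixed_space_def subspace_diff subspace_scale)
  qed
  have Fx: "bform p q f x = 0" if "f \<in> ?F" for f
    using that x by (simp add: perp_def)
  show "nondegenerate p q (fixed_space p q T')"
    unfolding nondegenerate_def
  proof (intro ballI impI)
    fix v assume v: "v \<in> fixed_space p q T'" and orth: "\<forall>w\<in>fixed_space p q T'. bform p q v w = 0"
    obtain c where c: "v - c *\<^sub>R x \<in> ?F"
      using decomp[OF v] by blast
    have "bform p q v x = 0"
      using orth xF' by blast
    with Fx[OF c] x(2) have "c = 0"
      by (simp add: bform_linear_simps)
    then have "v \<in> ?F"
      using c by simp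
    then show "v = 0"
      using F orth sub1 by (auto simp: nondegenerate_def)
  qed
  have "perp p q (fixed_space p q T') = {u \<in> perp p q ?F. bform p q u x = 0}"
  proof (intro equalityI subsetI)
    fix u assume "u \<in> perp p q (fixed_space p q T')"
    then show "u \<in> {u \<in> perp p q ?F. bform p q u x = 0}"
      using sub1 xF' bform_commute[of p q u x] by (auto simp: perp_def)
  next
    fix u assume u: "u \<in> {u \<in> perp p q ?F. bform p q u x = 0}"
    have "bform p q v u = 0" if v: "v \<in> fixed_space p q T'" for v
    proof -
      obtain c where "v - c *\<^sub>R x \<in> ?F"
        using decomp[OF v] by blast
      then have "bform p q (v - c *\<^sub>R x) u = 0"
        using u by (simp add: perp_def)
      then show ?thesis
        using u bform_commute[of p q x u] by (simp add: bform_linear_simps)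
    qed
    then show "u \<in> perp p q (fixed_space p q T')"
      using u by (simp add: perp_def)
  qed
  then show "dim (perp p q ?F) = Suc (dim (perp p q (fixed_space p q T')))"
    using dim_orthogonal_complement[OF subspace_perp _ x] by (auto simp: perp_def)
qed


section \<open>Blades\<close>

lemma minus_one_power_mult:
  fixes y :: "'a::real_algebra_1"
  shows "(- 1) ^ k * y = (- 1) ^ k *\<^sub>R y"
  by (cases "even k") simp_all

lemma linear_image_span_subset:
  fixes f :: "'a::real_vector \<Rightarrow> 'b::real_vector"
  assumes "linear f" "subspace S" "\<And>b. b \<in> B \<Longrightarrow> f b \<in> S" "y \<in> span B"
  shows "f y \<in> S"
proof -
  have "span B \<subseteq> f -` S"
    using assms(3) linear_subspace_vimage[OF assms(1,2)] by (intro span_minimal) auto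
  then show ?thesis
    using assms(4) by auto
qed

text \<open>Like \<open>emb\<close>, the map \<open>h\<close> is additive and homogeneous only on
  \<open>Rpq p q\<close>, so it need not be \<open>linear\<close> on the whole function
  type.\<close>

lemma Rpq_unit_vec_induct:
  fixes h :: "(nat \<Rightarrow> real) \<Rightarrow> 'b::real_vector"
  assumes "x \<in> Rpq p q" "subspace S"
    and "\<And>i. i \<in> {1..p + q} \<Longrightarrow> h (unit_vec i) \<in> S"
    and add: "\<And>x y. x \<in> Rpq p q \<Longrightarrow> y \<in> Rpq p q \<Longrightarrow> h (x + y) = h x + h y"
    and scale: "\<And>c x. x \<in> Rpq p q \<Longrightarrow> h (c *\<^sub>R x) = c *\<^sub>R h x"
  shows "h x \<in> S"
proof -
  have "h 0 = 0"
    using scale[OF subspace_0[OF subspace_Rpq], of 0] by simp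
  then have "subspace {x \<in> Rpq p q. h x \<in> S}"
    using assms(2) add scale subspace_Rpq[of p q] by (simp add: subspace_def)
  then have "span (unit_vec ` {1..p + q}) \<subseteq> {x \<in> Rpq p q. h x \<in> S}"
    using assms(3) unit_vec_in_Rpq by (intro span_minimal) auto
  then show ?thesis
    using Rpq_subset_span assms(1) by blast
qed

lemma basis_blade_empty: "basis_blade emb {} = 1"
  by (simp add: basis_blade_def)

lemma basis_blade_insert_min:
  assumes "finite A" "\<forall>a\<in>A. b < a"
  shows "basis_blade emb (insert b A) = emb (unit_vec b) * basis_blade emb A"
proof -
  have "Min (insert b A) = b"
    using assms by (intro Min_eqI) auto
  moreover have "insert b A - {b} = A"
    using assms by auto
  ultimately show ?thesis
    using assms by (simp only: basis_blade_def sorted_list_of_set_nonempty finite_insert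
        insert_not_empty not_False_eq_True list.map prod_list.Cons)
qed

text \<open>Symmetric difference with {i}: up to a scalar, e_i e_A is the blade of this index
  set.\<close>

definition flip :: "nat \<Rightarrow> nat set \<Rightarrow> nat set" where
  "flip i A = (if i \<in> A then A - {i} else insert i A)"

lemma flip_subset: "A \<subseteq> N \<Longrightarrow> i \<in> N \<Longrightarrow> flip i A \<subseteq> N"
  by (auto simp: flip_def)

lemma card_flip:
  assumes "finite A"
  shows "card (flip i A) \<le> Suc (card A)" "even (card (flip i A)) \<longleftrightarrow> odd (card A)"
proof -
  have "card A = Suc (card (A - {i}))" if "i \<in> A"
    using card_Suc_Diff1[OF assms that] by simp
  then show "card (flip i A) \<le> Suc (card A)" "even (card (flip i A)) \<longleftrightarrow> odd (card A)"
    using assms by (auto simp: flip_def)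
qed

context clifford_algebra
begin

section \<open>Clifford relations and multiplication of blades\<close>

lemma emb_diff: "x \<in> Rpq p q \<Longrightarrow> y \<in> Rpq p q \<Longrightarrow> emb (x - y) = emb x - emb y"
  using emb_add[of x "- 1 *\<^sub>R y"] emb_scale[of y "- 1"] subspace_scale[OF subspace_Rpq, of y p q "- 1"]
  by simp

text \<open>Polarization of \<open>emb_square\<close>, applied to x + y.\<close>

lemma emb_anticommutator:
  assumes "x \<in> Rpq p q" "y \<in> Rpq p q"
  shows "emb x * emb y = (2 * bform p q x y) *\<^sub>R 1 - emb y * emb x"
proof -
  have "emb (x + y) * emb (x + y) = of_real (bform p q (x + y) (x + y))"
    using assms subspace_Rpq by (intro emb_square subspace_add)
  then have "emb x * emb x + emb x * emb y + (emb y * emb x + emb y * emb y) =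
      of_real (bform p q x x) + of_real (2 * bform p q x y) + of_real (bform p q y y)"
    using assms bform_commute[of p q y x] by (simp add: emb_add algebra_simps bform_linear_simps)
  then show ?thesis
    using assms by (simp add: emb_square of_real_def algebra_simps)
qed

lemma emb_mult_cancel:
  assumes "invertible_vec p q a" "emb a * y = 0"
  shows "y = 0"
proof -
  have "emb a * (emb a * y) = bform p q a a *\<^sub>R y"
    using assms(1) by (simp add: invertible_vec_def emb_square of_real_def flip: mult.assoc)
  then show ?thesis
    using assms by (simp add: invertible_vec_def)
qed

lemma unit_vec_square:
  assumes "i \<in> {1..p + q}"
  obtains c where "c \<noteq> 0" "\<And>y. emb (unit_vec i) * (emb (unit_vec i) * y) = c *\<^sub>R y"
proof
  show "bform p q (unit_vec i) (unit_vec i) \<noteq> 0"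
    using bform_unit_vec[OF assms] by (simp add: unit_vec_def)
  fix y
  show "emb (unit_vec i) * (emb (unit_vec i) * y) = bform p q (unit_vec i) (unit_vec i) *\<^sub>R y"
    using unit_vec_in_Rpq[OF assms] by (simp add: emb_square of_real_def flip: mult.assoc)
qed

lemma unit_vec_anticommute:
  assumes "i \<in> {1..p + q}" "j \<in> {1..p + q}" "i \<noteq> j"
  shows "emb (unit_vec i) * emb (unit_vec j) = - (emb (unit_vec j) * emb (unit_vec i))"
  using emb_anticommutator[OF assms(1,2)[THEN unit_vec_in_Rpq]] bform_unit_vec[OF assms(2)] assms(3)
  by (simp add: unit_vec_def)

text \<open>Induction that adds a new least index b: e_i becomes the first factor, or meets e_b and
  squares to a scalar, or anticommutes past e_b into the smaller blade.\<close>

lemma unit_vec_mult_blade: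
  assumes "A \<subseteq> {1..p + q}" "i \<in> {1..p + q}"
  obtains c where "emb (unit_vec i) * basis_blade emb A = c *\<^sub>R basis_blade emb (flip i A)"
proof -
  have "finite A"
    using assms(1) finite_subset by blast
  then have "\<exists>c. emb (unit_vec i) * basis_blade emb A = c *\<^sub>R basis_blade emb (flip i A)"
    using assms(1)
  proof (induction A rule: finite_linorder_min_induct)
    case empty
    then show ?case
      using basis_blade_insert_min[of "{}" i emb] by (auto simp: flip_def intro: exI[of _ 1])
  next
    case (insert b A)
    have b: "b \<notin> A" "b \<in> {1..p + q}"
      using insert by auto
    have blade: "basis_blade emb (insert b A) = emb (unit_vec b) * basis_blade emb A"
      using insert by (intro basis_blade_insert_min)
    consider "i < b" | "i = b" | "b < i"
      by linarith
    then show ?case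
    proof cases
      case 1
      then have "i \<notin> insert b A" "\<forall>a\<in>insert b A. i < a"
        using insert.hyps by force+
      then show ?thesis
        using basis_blade_insert_min[of "insert b A" i emb] insert.hyps(1)
        by (auto simp: flip_def intro: exI[of _ 1])
    next
      case 2
      then have "flip i (insert b A) = A"
        using b by (auto simp: flip_def)
      then show ?thesis
        using 2 blade unit_vec_square[OF assms(2)] by metis
    next
      case 3
      obtain c where c: "emb (unit_vec i) * basis_blade emb A = c *\<^sub>R basis_blade emb (flip i A)"
        using insert by auto
      have "flip i (insert b A) = insert b (flip i A)" "\<forall>a\<in>flip i A. b < a" "finite (flip i A)"
        using 3 insert.hyps by (auto simp: flip_def)
      then have blade': "basis_blade emb (flip i (insert b A)) =
          emb (unit_vec b) * basis_blade emb (flip i A)"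
        using basis_blade_insert_min by metis
      have "emb (unit_vec i) * basis_blade emb (insert b A) =
          - (emb (unit_vec b) * (emb (unit_vec i) * basis_blade emb A))"
        using unit_vec_anticommute[OF assms(2) b(2)] 3 by (simp add: blade flip: mult.assoc)
      also have "\<dots> = - c *\<^sub>R basis_blade emb (flip i (insert b A))"
        by (simp add: c blade')
      finally show ?thesis
        by blast
    qed
  qed
  then show thesis
    using that by blast
qed

text \<open>Moving e_i to the left costs one sign for each factor of the blade, except for a factor
  e_i itself; this accounts for the extra minus when i is in A.\<close>

lemma blade_mult_unit_vec:
  assumes "A \<subseteq> {1..p + q}" "i \<in> {1..p + q}"
  shows "basis_blade emb A * emb (unit_vec i) =
    (if i \<in> A then - ((- 1) ^ card A) else (- 1) ^ card A) *\<^sub>R (emb (unit_vec i) * basis_blade emb A)"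
proof -
  have "finite A"
    using assms(1) finite_subset by blast
  then show ?thesis
    using assms(1)
  proof (induction A rule: finite_linorder_min_induct)
    case empty
    then show ?case
      by (simp add: basis_blade_empty)
  next
    case (insert b A)
    have b: "b \<notin> A" "b \<in> {1..p + q}"
      using insert by auto
    have blade: "basis_blade emb (insert b A) = emb (unit_vec b) * basis_blade emb A"
      using insert by (intro basis_blade_insert_min)
    have IH: "basis_blade emb A * emb (unit_vec i) =
      (if i \<in> A then - ((- 1) ^ card A) else (- 1) ^ card A) *\<^sub>R (emb (unit_vec i) * basis_blade emb A)"
      using insert by auto
    show ?case
    proof (cases "i = b")
      case True
      then show ?thesis
        using b IH insert.hyps(1) by (simp add: blade mult.assoc)
    next
      case False
      have "emb (unit_vec b) * (emb (unit_vec i) * basis_blade emb A) =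
          - (emb (unit_vec i) * (emb (unit_vec b) * basis_blade emb A))"
        using unit_vec_anticommute[OF b(2) assms(2)] False by (simp flip: mult.assoc)
      then show ?thesis
        using b IH insert.hyps(1) False by (simp add: blade mult.assoc)
    qed
  qed
qed

text \<open>The elements whose left multiplication preserves the span of the blades form a
  subalgebra containing the generators, hence everything; applying them to 1 gives the
  claim.\<close>

lemma span_blades: "span (basis_blade emb ` Pow {1..p + q}) = UNIV"
proof -
  let ?S = "span (basis_blade emb ` Pow {1..p + q})"
  let ?L = "{a. \<forall>b\<in>?S. a * b \<in> ?S}"
  have unit: "emb (unit_vec i) * b \<in> ?S" if i: "i \<in> {1..p + q}" and b: "b \<in> ?S" for i b
  proof (rule linear_image_span_subset[where f = "(*) (emb (unit_vec i))", OF _ subspace_span _ b])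
    show "linear ((*) (emb (unit_vec i)))"
      by (rule linear_times)
    fix v assume "v \<in> basis_blade emb ` Pow {1..p + q}"
    then obtain A where A: "A \<subseteq> {1..p + q}" "v = basis_blade emb A"
      by auto
    then obtain c where "emb (unit_vec i) * v = c *\<^sub>R basis_blade emb (flip i A)"
      using unit_vec_mult_blade i by metis
    then show "emb (unit_vec i) * v \<in> ?S"
      using flip_subset[OF A(1) i] by (simp add: span_scale span_base)
  qed
  have "?L = UNIV"
  proof (rule generated)
    show "subspace ?L"
      by (auto simp: subspace_def distrib_right span_zero span_add span_scale)
    show "range of_real \<subseteq> ?L"
      by (auto simp: of_real_def span_scale)
    show "emb ` Rpq p q \<subseteq> ?L"
    proof clarify
      fix x b assume x: "x \<in> Rpq p q" and b: "b \<in> ?S"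
      show "emb x * b \<in> ?S"
        by (rule Rpq_unit_vec_induct[where h = "\<lambda>x. emb x * b", OF x subspace_span])
          (simp_all only: unit[OF _ b] emb_add emb_scale distrib_right mult_scaleR_left)
    qed
  qed (auto simp: mult.assoc)
  moreover have "basis_blade emb {} \<in> ?S"
    by (intro span_base imageI) simp
  then have "1 \<in> ?S"
    by (simp add: basis_blade_empty)
  ultimately have "a * 1 \<in> ?S" for a
    by blast
  then show ?thesis
    by auto
qed

text \<open>By counting: a maximal independent set of blades has 2^(p+q) elements by the dimension
  axiom, while there are at most that many blades. So none are dropped and none coincide.\<close>

lemma independent_blades:
  shows "independent (basis_blade emb ` Pow {1..p + q})"
    and "inj_on (basis_blade emb) (Pow {1..p + q})"
proof -
  let ?E = "basis_blade emb ` Pow {1..p + q}"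
  have "card ?E \<le> 2 ^ (p + q)"
    using card_image_le[of "Pow {1..p + q}" "basis_blade emb"] by (simp add: card_Pow)
  moreover obtain B where B: "B \<subseteq> ?E" "independent B" "?E \<subseteq> span B"
    by (rule maximal_independent_subset)
  moreover have "span B = UNIV"
    using span_minimal[OF B(3) subspace_span] span_blades by auto
  then have "card B = 2 ^ (p + q)"
    using basis_card_eq_dim[of B UNIV] B(2) by (simp add: dim_algebra)
  ultimately have "B = ?E"
    by (intro card_seteq) auto
  with \<open>independent B\<close> show "independent ?E"
    by simp
  show "inj_on (basis_blade emb) (Pow {1..p + q})"
    using \<open>B = ?E\<close> \<open>card B = _\<close> by (intro eq_card_imp_inj_on) (simp_all add: card_Pow)
qed

section \<open>The filtration by grade, split by parity\<close>

text \<open>Only the parity of \<open>k\<close> matters. The strict bound makes level 0 the zero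
  space, and an element has grade m when it lies in level \<open>Suc m\<close> but not in level
  m.\<close>

definition filtration :: "nat \<Rightarrow> nat \<Rightarrow> 'a set" where
  "filtration k j =
     span {basis_blade emb A |A. A \<subseteq> {1..p + q} \<and> card A < j \<and> even (card A + k)}"

lemma filtration_Suc_Suc: "filtration (Suc (Suc k)) j = filtration k j"
  by (simp add: filtration_def)

lemma filtration_0: "filtration k 0 = {0}"
  by (simp add: filtration_def)

lemma filtration_top: "filtration k j \<subseteq> filtration k (Suc (p + q))"
proof -
  have "card A < Suc (p + q)" if "A \<subseteq> {1..p + q}" for A
    using card_mono[OF _ that] by simp
  then show ?thesis
    unfolding filtration_def by (intro span_mono) blast
qed

lemma blade_in_filtration:
  "A \<subseteq> {1..p + q} \<Longrightarrow> card A < j \<Longrightarrow> even (card A + k) \<Longrightarrow> basis_blade emb A \<in> filtration k j"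
  unfolding filtration_def by (intro span_base) auto

lemma subspace_filtration: "subspace (filtration k j)"
  by (simp add: filtration_def)

lemma emb_mult_filtration:
  assumes x: "x \<in> Rpq p q" and y: "y \<in> filtration k j"
  shows "emb x * y \<in> filtration (Suc k) (Suc j)"
proof (rule Rpq_unit_vec_induct[where h = "\<lambda>x. emb x * y", OF x subspace_filtration])
  fix i assume i: "i \<in> {1..p + q}"
  show "emb (unit_vec i) * y \<in> filtration (Suc k) (Suc j)"
  proof (rule linear_image_span_subset[where f = "(*) (emb (unit_vec i))",
        OF linear_times subspace_filtration _ y[unfolded filtration_def]])
    fix v assume "v \<in> {basis_blade emb A |A. A \<subseteq> {1..p + q} \<and> card A < j \<and> even (card A + k)}"
    then obtain A where A: "A \<subseteq> {1..p + q}" "card A < j" "even (card A + k)"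
      "v = basis_blade emb A"
      by auto
    have "finite A"
      using A(1) finite_subset by blast
    obtain c where "emb (unit_vec i) * v = c *\<^sub>R basis_blade emb (flip i A)"
      using unit_vec_mult_blade[OF A(1) i] A(4) by metis
    moreover have "basis_blade emb (flip i A) \<in> filtration (Suc k) (Suc j)"
      using A card_flip[OF \<open>finite A\<close>, of i] flip_subset[OF A(1) i]
      by (intro blade_in_filtration) auto
    ultimately show "emb (unit_vec i) * v \<in> filtration (Suc k) (Suc j)"
      using subspace_filtration by (simp add: subspace_scale)
  qed
qed (auto simp: emb_add emb_scale distrib_right)

text \<open>On elements of parity \<open>k\<close> this is twice the left contraction by \<open>x\<close>.\<close>

definition contract :: "nat \<Rightarrow> (nat \<Rightarrow> real) \<Rightarrow> 'a \<Rightarrow> 'a" where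
  "contract k x y = emb x * y - (- 1) ^ k *\<^sub>R (y * emb x)"

lemma linear_contract: "linear (contract k x)"
  by (rule linearI) (simp_all add: contract_def algebra_simps)

text \<open>For a blade of parity \<open>k\<close>, the two terms of \<open>contract\<close> cancel
  if e_i is not a factor and agree if it is.\<close>

lemma contract_unit_vec_blade:
  assumes "A \<subseteq> {1..p + q}" "i \<in> {1..p + q}" "even (card A + k)"
  shows "contract k (unit_vec i) (basis_blade emb A) =
    (if i \<in> A then 2 *\<^sub>R (emb (unit_vec i) * basis_blade emb A) else 0)"
proof -
  have "(- 1 :: real) ^ k = (- 1) ^ card A"
    using assms(3) by (auto simp: uminus_power_if)
  then show ?thesis
    using blade_mult_unit_vec[OF assms(1,2)]
    by (simp add: contract_def scaleR_2 flip: power_mult_distrib power_add mult_2)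
qed

lemma contract_filtration:
  assumes x: "x \<in> Rpq p q" and y: "y \<in> filtration k (Suc j)"
  shows "contract k x y \<in> filtration (Suc k) j"
proof (rule Rpq_unit_vec_induct[where h = "\<lambda>x. contract k x y", OF x subspace_filtration])
  fix i assume i: "i \<in> {1..p + q}"
  show "contract k (unit_vec i) y \<in> filtration (Suc k) j"
  proof (rule linear_image_span_subset[OF linear_contract subspace_filtration _ y[unfolded filtration_def]])
    fix v assume "v \<in> {basis_blade emb A |A. A \<subseteq> {1..p + q} \<and> card A < Suc j \<and> even (card A + k)}"
    then obtain A where A: "A \<subseteq> {1..p + q}" "card A < Suc j" "even (card A + k)"
      "v = basis_blade emb A"
      by auto
    have "finite A"
      using A(1) finite_subset by blast
    show "contract k (unit_vec i) v \<in> filtration (Suc k) j"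
    proof (cases "i \<in> A")
      case True
      then have "card A = Suc (card (flip i A))"
        using card_Suc_Diff1[OF \<open>finite A\<close> True] by (simp add: flip_def)
      then have "card (flip i A) < j" "even (card (flip i A) + Suc k)"
        using A(2,3) by simp_all
      then have "basis_blade emb (flip i A) \<in> filtration (Suc k) j"
        by (rule blade_in_filtration[OF flip_subset[OF A(1) i]])
      moreover obtain c where "emb (unit_vec i) * v = c *\<^sub>R basis_blade emb (flip i A)"
        using unit_vec_mult_blade[OF A(1) i] A(4) by metis
      ultimately show ?thesis
        using A contract_unit_vec_blade[OF A(1) i A(3)] True subspace_filtration
        by (simp add: subspace_scale)
    next
      case False
      then show ?thesis
        using A contract_unit_vec_blade[OF A(1) i A(3)] subspace_0[OF subspace_filtration] by simp
    qed
  qed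
qed (auto simp: contract_def emb_add emb_scale algebra_simps)

text \<open>The indices are eliminated one at a time. Contraction by e_i kills the blades without
  e_i and is twice left multiplication by e_i, an injective map, on the span of the others; so the
  part of \<open>y\<close> involving e_i vanishes. In the end only the empty blade is left.\<close>

lemma scalar_if_contract_zero:
  assumes y: "y \<in> filtration k j"
    and zero: "\<And>x. x \<in> Rpq p q \<Longrightarrow> contract k x y = 0"
  shows "y \<in> filtration k 1"
proof -
  let ?S = "\<lambda>I. {basis_blade emb A |A. A \<subseteq> {1..p + q} - I \<and> even (card A + k)}"
  have "y \<in> span (?S I)" if "finite I" "I \<subseteq> {1..p + q}" for I
    using that
  proof (induction I)
    case empty
    have "filtration k j \<subseteq> span (?S {})"
      unfolding filtration_def by (intro span_mono) auto
    then show ?case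
      using y by blast
  next
    case (insert i I)
    let ?B = "{basis_blade emb A |A. A \<subseteq> {1..p + q} \<and> i \<in> A \<and> even (card A + k)}"
    have i: "i \<in> {1..p + q}"
      using insert by auto
    have "y \<in> span (?S I)"
      using insert by auto
    also have "span (?S I) \<subseteq> span (?S (insert i I) \<union> ?B)"
      by (intro span_mono) blast
    finally obtain u v where uv: "y = u + v" "u \<in> span (?S (insert i I))" "v \<in> span ?B"
      unfolding span_Un by blast
    let ?c = "contract k (unit_vec i)"
    have "?c u = 0"
    proof (rule linear_eq_0_on_span[OF linear_contract _ uv(2)])
      fix w assume "w \<in> ?S (insert i I)"
      then obtain A where "A \<subseteq> {1..p + q}" "i \<notin> A" "even (card A + k)" "w = basis_blade emb A"
        by blast
      then show "?c w = 0"
        using contract_unit_vec_blade[OF _ i, of A k] by simp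
    qed
    moreover have "?c v = 2 *\<^sub>R (emb (unit_vec i) * v)"
    proof (rule linear_eq_on_span[where f = ?c and g = "\<lambda>w. 2 *\<^sub>R (emb (unit_vec i) * w)", OF linear_contract _ _ uv(3)])
      show "linear (\<lambda>w. 2 *\<^sub>R (emb (unit_vec i) * w))"
        by (rule linearI) (simp_all add: algebra_simps)
    qed (use contract_unit_vec_blade[OF _ i] in auto)
    moreover have "?c u + ?c v = 0"
      using zero[OF unit_vec_in_Rpq[OF i]] linear_add[OF linear_contract] uv(1) by metis
    ultimately have "emb (unit_vec i) * v = 0"
      by simp
    then have "v = 0"
      using unit_vec_square[OF i] by (metis mult_zero_right scaleR_eq_0_iff)
    then show ?case
      using uv by simp
  qed
  from this[of "{1..p + q}"] have "y \<in> span (?S {1..p + q})"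
    by simp
  also have "span (?S {1..p + q}) \<subseteq> filtration k 1"
    unfolding filtration_def by (intro span_mono) auto
  finally show ?thesis .
qed

section \<open>The grade\<close>

lemma grade_space_eq: "grade_space p q emb r = span (basis_blade emb ` {A. A \<subseteq> {1..p + q} \<and> card A = r})"
  unfolding grade_space_def by (rule arg_cong[of _ _ span]) auto

text \<open>The families in \<open>grade_part\<close> are indexed by all naturals but summed only up
  to p + q; this makes them unique at the remaining indices too.\<close>

lemma grade_space_beyond:
  assumes "p + q < r"
  shows "grade_space p q emb r = {0}"
proof -
  have "card A \<noteq> r" if "A \<subseteq> {1..p + q}" for A
    using card_mono[OF _ that] assms by auto
  then have "{A. A \<subseteq> {1..p + q} \<and> card A = r} = {}"
    by blast
  then show ?thesis
    by (simp only: grade_space_eq image_empty span_empty)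
qed

text \<open>\<open>d i\<close> lies in the span of the blades of size i and, being minus the sum of
  the other terms, in the span of the remaining blades. These are disjoint parts of an independent
  set, so all coordinates of \<open>d i\<close> vanish.\<close>

lemma grade_decomposition_zero:
  assumes d: "\<And>i. d i \<in> grade_space p q emb i" and sum: "(\<Sum>i\<le>p + q. d i) = 0"
  shows "d i = 0"
proof (cases "i \<le> p + q")
  case False
  then show ?thesis
    using d[of i] grade_space_beyond[of i] by simp
next
  case True
  let ?E = "basis_blade emb ` Pow {1..p + q}"
  let ?B = "basis_blade emb ` {A. A \<subseteq> {1..p + q} \<and> card A = i}"
  let ?C = "basis_blade emb ` {A. A \<subseteq> {1..p + q} \<and> card A \<noteq> i}"
  have "(\<Sum>i\<le>p + q. d i) = d i + (\<Sum>j\<in>{..p + q} - {i}. d j)"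
    using True by (simp add: sum.remove)
  then have di: "d i = - (\<Sum>j\<in>{..p + q} - {i}. d j)"
    using sum by (simp add: eq_neg_iff_add_eq_0)
  have "grade_space p q emb j \<subseteq> span ?C" if "j \<noteq> i" for j
    unfolding grade_space_eq using that by (intro span_mono) auto
  then have "d j \<in> span ?C" if "j \<noteq> i" for j
    using d that by blast
  then have C: "d i \<in> span ?C"
    unfolding di by (intro span_neg span_sum) auto
  have B: "d i \<in> span ?B"
    using d[of i] unfolding grade_space_eq .
  have E: "?B \<subseteq> ?E" "?C \<subseteq> ?E"
    by auto
  have disjoint: "?B \<inter> ?C = {}"
    using independent_blades(2) by (auto simp: inj_on_def)
  have "representation ?B (d i) = representation ?C (d i)"
    using representation_extend[OF independent_blades(1) B E(1)]
      representation_extend[OF independent_blades(1) C E(2)] by simp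
  then have "representation ?B (d i) b = 0" for b
    using representation_ne_zero[of ?B "d i" b] representation_ne_zero[of ?C "d i" b] disjoint
    by auto
  then show ?thesis
    using sum_nonzero_representation_eq[OF _ B] independent_mono[OF independent_blades(1) E(1)]
    by simp
qed

lemma grade_part_eqI:
  assumes "\<And>i. f i \<in> grade_space p q emb i" "y = (\<Sum>i\<le>p + q. f i)"
  shows "grade_part p q emb r y = f r"
proof -
  have "g = f" if "\<forall>i. g i \<in> grade_space p q emb i" "y = (\<Sum>i\<le>p + q. g i)" for g
  proof
    fix i
    have "g i - f i = 0"
      by (rule grade_decomposition_zero[of "\<lambda>i. g i - f i"])
        (use that assms in \<open>simp_all add: grade_space_def span_diff sum_subtractf\<close>)
    then show "g i = f i"
      by simp
  qed
  then have "(THE f. (\<forall>i. f i \<in> grade_space p q emb i) \<and> y = (\<Sum>i\<le>p + q. f i)) = f"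
    using assms by (intro the_equality) blast+
  then show ?thesis
    by (simp add: grade_part_def)
qed

lemma filtration_Suc_decomposition:
  assumes "y \<in> filtration k (Suc m)"
  obtains g h where "y = g + h" "g \<in> filtration k m" "h \<in> grade_space p q emb m"
proof -
  let ?G = "{basis_blade emb A |A. A \<subseteq> {1..p + q} \<and> card A < m \<and> even (card A + k)}"
  let ?H = "{basis_blade emb A |A. A \<subseteq> {1..p + q} \<and> card A = m}"
  have "filtration k (Suc m) \<subseteq> span (?G \<union> ?H)"
    unfolding filtration_def by (intro span_mono) (auto simp: less_Suc_eq)
  then show thesis
    using assms that unfolding span_Un filtration_def grade_space_def by blast
qed

lemma filtration_decomposition:
  assumes "y \<in> filtration k m"
  shows "\<exists>f. (\<forall>i. f i \<in> grade_space p q emb i) \<and> (\<forall>i\<ge>m. f i = 0) \<and> y = (\<Sum>i<m. f i)"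
  using assms
proof (induction m arbitrary: y)
  case 0
  then show ?case
    by (auto simp: filtration_0 grade_space_def span_zero intro!: exI[of _ "\<lambda>_. 0"])
next
  case (Suc m)
  obtain g h where gh: "y = g + h" "g \<in> filtration k m" "h \<in> grade_space p q emb m"
    using filtration_Suc_decomposition[OF Suc.prems] .
  obtain f where "\<forall>i. f i \<in> grade_space p q emb i" "\<forall>i\<ge>m. f i = 0" "g = (\<Sum>i<m. f i)"
    using Suc.IH[OF gh(2)] by blast
  then show ?case
    using gh by (intro exI[of _ "f(m := h)"]) auto
qed

text \<open>Replaces both definite descriptions behind \<open>grade\<close> by membership in two
  consecutive filtration levels of one parity.\<close>

lemma grade_eqI:
  assumes y: "y \<in> filtration k (Suc m)" "y \<notin> filtration k m"
  shows "grade p q emb y = m"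
proof -
  obtain g h where gh: "y = g + h" "g \<in> filtration k m" "h \<in> grade_space p q emb m"
    using filtration_Suc_decomposition[OF y(1)] .
  have "h \<noteq> 0"
    using gh y(2) by auto
  \<comment> \<open>This ensures that the top term \<open>h\<close> actually occurs in the sum up to
    p + q.\<close>
  then have m: "m \<le> p + q"
    using gh(3) grade_space_beyond[of m] by (cases "m \<le> p + q") simp_all
  obtain f where f: "\<forall>i. f i \<in> grade_space p q emb i" "\<forall>i\<ge>m. f i = 0" "g = (\<Sum>i<m. f i)"
    using filtration_decomposition[OF gh(2)] by blast
  let ?f = "f(m := h)"
  have "(\<Sum>i\<le>p + q. ?f i) = (\<Sum>i<Suc m. ?f i)"
    using m f(2) by (intro sum.mono_neutral_right) auto
  also have "\<dots> = y"
    using gh f by simp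
  finally have part: "grade_part p q emb r y = ?f r" for r
    using f(1) gh(3) by (intro grade_part_eqI) auto
  show ?thesis
    unfolding grade_def part
  proof (rule the_equality)
    show "?f m \<noteq> 0 \<and> (\<forall>r>m. ?f r = 0)"
      using f(2) \<open>h \<noteq> 0\<close> by simp
    fix t assume t: "?f t \<noteq> 0 \<and> (\<forall>r>t. ?f r = 0)"
    then show "t = m"
      using f(2) \<open>h \<noteq> 0\<close> by (metis fun_upd_apply linorder_less_linear order_less_imp_le)
  qed
qed

section \<open>Products of invertible vectors\<close>

lemma prod_list_emb_filtration:
  "set ss \<subseteq> Rpq p q \<Longrightarrow> prod_list (map emb ss) \<in> filtration (length ss) (Suc (length ss))"
proof (induction ss)
  case Nil
  then show ?case
    using blade_in_filtration[of "{}" 1 0] by (simp add: basis_blade_empty)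
qed (auto intro: emb_mult_filtration)

lemma prod_list_emb_nonzero:
  "\<forall>s\<in>set ss. invertible_vec p q s \<Longrightarrow> prod_list (map emb ss) \<noteq> 0"
  by (induction ss) (auto dest: emb_mult_cancel)

lemma prod_list_inverse:
  assumes "\<forall>s\<in>set ss. invertible_vec p q s"
  shows "prod_list (map (\<lambda>s. emb (vec_inv p q s)) (rev ss)) * prod_list (map emb ss) = 1"
  using assms
proof (induction ss)
  case (Cons s ss)
  have "emb (vec_inv p q s) * emb s = 1"
    using Cons.prems by (simp add: invertible_vec_def vec_inv_def emb_scale emb_square of_real_def)
  then have "emb (vec_inv p q s) * (emb s * y) = y" for y
    by (simp flip: mult.assoc)
  then show ?case
    using Cons by (simp add: mult.assoc)
qed simp

section \<open>Versors\<close>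

text \<open>The reflection is w |-> -a w a^(-1), here multiplied by a on the right to avoid the
  inverse.\<close>

lemma emb_reflect:
  assumes a: "a \<in> Rpq p q" "bform p q a a \<noteq> 0" and w: "w \<in> Rpq p q"
  shows "emb (reflect p q a w) * emb a = - (emb a * emb w)"
proof -
  have "emb (reflect p q a w) = emb w - (2 * bform p q w a / bform p q a a) *\<^sub>R emb a"
    using a w subspace_Rpq by (simp add: reflect_def emb_diff emb_scale subspace_scale)
  then have "emb (reflect p q a w) * emb a = emb w * emb a - (2 * bform p q w a) *\<^sub>R 1"
    using a by (simp add: left_diff_distrib emb_square of_real_def)
  then show ?thesis
    using emb_anticommutator[OF w a(1)] by simp
qed

text \<open>Stated for an arbitrary nonzero \<open>s\<close> of parity \<open>k\<close> that
  intertwines T with the identity up to sign, not for a product of vectors, so that the induction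
  can pass to \<open>emb a * s\<close> and \<open>Suc k\<close>.\<close>

lemma versor_grade:
  assumes "orthogonal_operator p q T" "nondegenerate p q (fixed_space p q T)"
    and "s \<noteq> 0" "s \<in> filtration k (Suc (p + q))"
    and "\<forall>v\<in>Rpq p q. emb (T v) * s = (- 1) ^ k *\<^sub>R (s * emb v)"
    and "dim (perp p q (fixed_space p q T)) = m"
  shows "product_of_reflections p q m T \<and> s \<in> filtration k (Suc m) \<and> s \<notin> filtration k m"
  using assms
proof (induction m arbitrary: T s k)
  case base: 0
  show ?case
  proof (cases "fixed_space p q T = Rpq p q")
    case True
    then have T: "T v = v" if "v \<in> Rpq p q" for v
      using that by (auto simp: fixed_space_def)
    \<comment> \<open>For the identity operator the relation between T and \<open>s\<close> says
      exactly that all contractions vanish.\<close>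
    then have "contract k v s = 0" if "v \<in> Rpq p q" for v
      using base.prems(5) that by (simp add: contract_def)
    then have "s \<in> filtration k 1"
      using scalar_if_contract_zero[OF base.prems(4)] by blast
    then show ?thesis
      using T base.prems(3) by (auto simp: filtration_0 product_of_reflections_def)
  next
    case False
    obtain x where x: "x \<in> perp p q (fixed_space p q T)" "bform p q x x \<noteq> 0"
      using ex_reduction_vector[OF base.prems(1,2) False] .
    then show ?thesis
      using dim_orthogonal_complement[OF subspace_perp _ x] base.prems(6) by (auto simp: perp_def)
  qed
next
  case (Suc m)
  \<comment> \<open>If T fixed everything, the complement would be zero and not of dimension
    \<open>Suc m\<close>.\<close>
  have "fixed_space p q T \<noteq> Rpq p q"
  proof
    assume "fixed_space p q T = Rpq p q"
    then have "perp p q (fixed_space p q T) \<subseteq> {0}"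
      using bform_nondegenerate by (auto simp: perp_def bform_commute)
    then have "dim (perp p q (fixed_space p q T)) \<le> 0"
      using dim_le_card[of _ "{}"] by simp
    then show False
      using Suc.prems(6) by simp
  qed
  then obtain x where x: "x \<in> perp p q (fixed_space p q T)" "bform p q x x \<noteq> 0"
    and Tx: "bform p q (T x - x) (T x - x) \<noteq> 0"
    using ex_reduction_vector[OF Suc.prems(1,2)] by blast
  define a where "a = T x - x"
  define T' where "T' = reflect p q a \<circ> T"
  have TV: "T v \<in> Rpq p q" if "v \<in> Rpq p q" for v
    using Suc.prems(1) that by (simp add: orthogonal_operator_def linear_operator_def)
  have xV: "x \<in> Rpq p q"
    using x by (simp add: perp_def)
  have aV: "a \<in> Rpq p q"
    using TV xV subspace_Rpq by (simp add: a_def subspace_diff)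
  have aa: "bform p q a a \<noteq> 0"
    using Tx by (simp add: a_def)
  have inv_a: "invertible_vec p q a"
    using aV aa by (simp add: invertible_vec_def)
  note red = reflect_comp_reduces_displacement[OF Suc.prems(1,2) x a_def aa T'_def]
  let ?s = "emb a * s"
  have T's: "emb (T' v) * ?s = (- 1) ^ Suc k *\<^sub>R (?s * emb v)" if "v \<in> Rpq p q" for v
  proof -
    have "emb (T' v) * ?s = - (emb a * (emb (T v) * s))"
      using emb_reflect[OF aV aa TV[OF that]] by (simp add: T'_def flip: mult.assoc)
    also have "\<dots> = (- 1) ^ Suc k *\<^sub>R (?s * emb v)"
      using Suc.prems(5) that by (simp add: mult.assoc)
    finally show ?thesis .
  qed
  have "?s \<in> filtration (Suc k) (Suc (p + q))"
    using emb_mult_filtration[OF aV Suc.prems(4)] filtration_top by blast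
  moreover have "?s \<noteq> 0"
    using emb_mult_cancel[OF inv_a] Suc.prems(3) by blast
  ultimately have IH: "product_of_reflections p q m T'" "?s \<in> filtration (Suc k) (Suc m)"
    "?s \<notin> filtration (Suc k) m"
    using Suc.IH[OF red(1,2), of ?s "Suc k"] T's red(3) Suc.prems(6) by auto
  \<comment> \<open>Multiplying by the vector a once more recovers \<open>s\<close> up to a nonzero
    factor, which gives the upper bound on its grade.\<close>
  have "bform p q a a *\<^sub>R s = emb a * ?s"
    using aV by (simp add: emb_square of_real_def flip: mult.assoc)
  then have "s = (1 / bform p q a a) *\<^sub>R (emb a * ?s)"
    using aa by (simp flip: \<open>bform p q a a *\<^sub>R s = _\<close>)
  moreover have "emb a * ?s \<in> filtration k (Suc (Suc m))"
    using emb_mult_filtration[OF aV IH(2)] by (simp add: filtration_Suc_Suc)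
  ultimately have "s \<in> filtration k (Suc (Suc m))"
    using subspace_scale[OF subspace_filtration] by metis
  moreover have "s \<notin> filtration k (Suc m)"
  proof
    assume "s \<in> filtration k (Suc m)"
    then have "- 1 *\<^sub>R contract k x s \<in> filtration (Suc k) m"
      using contract_filtration[OF xV] subspace_scale[OF subspace_filtration] by blast
    moreover have "?s = - 1 *\<^sub>R contract k x s"
      using Suc.prems(5) xV TV by (simp add: a_def emb_diff left_diff_distrib contract_def)
    ultimately show False
      using IH(3) by simp
  qed
  moreover have "product_of_reflections p q (Suc m) T"
  proof -
    obtain \<phi>s where \<phi>s: "length \<phi>s = m" "\<forall>\<phi>\<in>set \<phi>s. hyperplane_reflection p q \<phi>"
      "\<forall>v\<in>Rpq p q. T' v = foldr (\<circ>) \<phi>s id v"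
      using IH(1) by (auto simp: product_of_reflections_def)
    \<comment> \<open>The reflection is its own inverse, so T is the reflection composed with
      T'.\<close>
    have "T v = foldr (\<circ>) (reflect p q a # \<phi>s) id v" if "v \<in> Rpq p q" for v
      using \<phi>s(3) that reflect_reflect[OF aa, of "T v"] by (simp add: T'_def)
    then show ?thesis
      unfolding product_of_reflections_def using \<phi>s(1,2) hyperplane_reflection_reflect[OF inv_a]
      by (intro exI[of _ "reflect p q a # \<phi>s"]) auto
  qed
  ultimately show ?case
    by blast
qed

end

theorem theorem6p2:
  fixes p q t :: nat
    and emb :: "(nat \<Rightarrow> real) \<Rightarrow> 'a::real_algebra_1"
    and T :: "(nat \<Rightarrow> real) \<Rightarrow> nat \<Rightarrow> real"
    and ss :: "(nat \<Rightarrow> real) list"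
  assumes "clifford_algebra p q emb"
    and "orthogonal_operator p q T"
    and "\<forall>s\<in>set ss. invertible_vec p q s"
    and "\<forall>x\<in>Rpq p q. emb (T x) =
           (- 1) ^ length ss * prod_list (map emb ss) * emb x
             * prod_list (map (\<lambda>s. emb (vec_inv p q s)) (rev ss))"
    and "grade p q emb (prod_list (map emb ss)) = t"
    and "nondegenerate p q (fixed_space p q T)"
  shows "product_of_reflections p q t T \<and> dim (perp p q (fixed_space p q T)) = t"
proof -
  interpret clifford_algebra p q emb
    by (fact assms(1))
  let ?s = "prod_list (map emb ss)"
  let ?m = "dim (perp p q (fixed_space p q T))"
  have "set ss \<subseteq> Rpq p q"
    using assms(3) by (auto simp: invertible_vec_def)
  then have "?s \<in> filtration (length ss) (Suc (p + q))"
    using prod_list_emb_filtration filtration_top by blast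
  \<comment> \<open>The hypothesis on T multiplied on the right by the product of the vectors, which
    cancels the inverses.\<close>
  moreover have "emb (T v) * ?s = (- 1) ^ length ss *\<^sub>R (?s * emb v)" if "v \<in> Rpq p q" for v
    using assms(4) that prod_list_inverse[OF assms(3)]
    by (simp add: mult.assoc minus_one_power_mult)
  ultimately have m: "product_of_reflections p q ?m T"
    "?s \<in> filtration (length ss) (Suc ?m)" "?s \<notin> filtration (length ss) ?m"
    using versor_grade[OF assms(2,6) prod_list_emb_nonzero[OF assms(3)]] by blast+
  have "t = ?m"
    using grade_eqI[OF m(2,3)] assms(5) by simp
  then show ?thesis
    using m(1) by simp
qed

end
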